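(* Let $G$ be a connected decomposable graph and let $\mathcal{P}=\{M_1,M_2,\ldots,M_k\}$ be a modular partition of $G$, with associated quotient graph $G/\mathcal{P}$. Then: 1. $G$ is word-representable if and only if, for each $1\le i\le k$, $G[M_i]$ is a comparability graph and $G/\mathcal{P}$ is a word-representable graph. 2. If $G$ is word-representable, then \[\mathcal{R}(G)=\max\{\mathcal{R}(G/\mathcal{P}),\ \mathcal{R}^p(G[M_1]),\ldots,\mathcal{R}^p(G[M_k])\}.\] 3. If $G$ is a comparability graph, then \[\mathcal{R}^p(G)=\max\{\mathcal{R}^p(G/\mathcal{P}),\ \mathcal{R}^p(G[M_1]),\ldots,\mathcal{R}^p(G[M_k])\}.\]
   Context: Graphs are simple (no loops or parallel edges) and undirected. For a graph $G=(V,E)$, $G[A]$ denotes the subgraph of $G$ induced by $A\subseteq V$, and $N_G(a)$ the set of neighbours of $a\in V$. Words. A word over a finite set of letters is a finite sequence of those letters. For a word $w$ over $V$ and $B\subseteq V$, $w_B$ is the word obtained from $w$ by deleting all occurrences of letters not in $B$. Two letters $a,b$ alternate in $w$ if $w_{\{a,b\}}$ is of the form $ababa\cdots$ or $babab\cdots$ (of even or odd length). A word $w$ over $V$ represents $G=(V,E)$ if any two vertices are adjacent in $G$ if and only if they alternate in $w$. $G$ is word-representable if some word over $V$ represents it. $G$ is $k$-word-representable if it is represented by a word in which every vertex appears exactly $k$ times; it is known that a graph is word-representable if and only if it is $k$-word-representable for some $k$. The representation number $\mathcal{R}(G)$ of a word-representable graph $G$ is the smallest such $k$. Comparability graphs.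 $G$ is a comparability graph if its edges can be oriented transitively (whenever $a\to b$ and $b\to c$, also $a\to c$). $G$ is permutationally $k$-representable if it is represented by a word $p_1p_2\cdots p_k$ with each $p_i$ a permutation of the vertices of $G$. It is known that a graph is a comparability graph if and only if it is permutationally $k$-representable for some $k$; the permutation-representation number $\mathcal{R}^p(G)$ is the smallest such $k$. Modules. A set $M\subseteq V$ is a module of $G$ if for every $a\in V\setminus M$ either $N_G(a)\cap M=\varnothing$ or $M\subseteq N_G(a)$. The singletons and the whole set $V$ are the trivial modules. A graph is prime if it contains only trivial modules, and decomposable otherwise. A modular partition of $G$ is a partition of the vertex set of $G$ each of whose parts is a module of $G$. Two disjoint modules are either adjacent (every vertex of one is adjacent to all vertices of the other) or non-adjacent (no vertex of one is adjacent to any vertex of the other). The quotient graph $G/\mathcal{P}$ has its vertices in bijection with the elements of $\mathcal{P}$, two vertices being adjacent if and only if the corresponding modules are adjacent in $G$.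
   Formalization: Items 1 and 2 are stated for modular partitions other than the one-part partition {V}; for that partition they fail, e.g. for a 5-cycle with one vertex duplicated, which is word-representable but not a comparability graph. *)

theory Defs
  imports
    "Graph_Theory.Digraph_Component"
    "HOL-Combinatorics.Multiset_Permutations"
    "HOL-Library.Disjoint_Sets"
begin

text \<open>
  A finite simple undirected graph is an instance of the locale \<open>graph\<close> of \<open>Graph_Theory\<close>:
  a finite symmetric digraph without loops and parallel arcs. Two vertices are adjacent iff
  one dominates the other.
\<close>

section \<open>Words\<close>

definition restrict_word :: "'a list \<Rightarrow> 'a set \<Rightarrow> 'a list" where
  "restrict_word w B = filter (\<lambda>x. x \<in> B) w"

text \<open>The word \<open>ababa\<dots>\<close> of length \<open>n\<close>.\<close>

definition alternating_word :: "'a \<Rightarrow> 'a \<Rightarrow> nat \<Rightarrow> 'a list" where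
  "alternating_word a b n = map (\<lambda>i. if even i then a else b) [0..<n]"

definition alternate :: "'a \<Rightarrow> 'a \<Rightarrow> 'a list \<Rightarrow> bool" where
  "alternate a b w \<longleftrightarrow>
    (\<exists>n. restrict_word w {a, b} = alternating_word a b n \<or>
         restrict_word w {a, b} = alternating_word b a n)"

definition represents :: "'a list \<Rightarrow> ('a, 'b) pre_digraph \<Rightarrow> bool" where
  "represents w G \<longleftrightarrow> set w \<subseteq> verts G \<and>
    (\<forall>a \<in> verts G. \<forall>b \<in> verts G. a \<noteq> b \<longrightarrow> (a \<rightarrow>\<^bsub>G\<^esub> b \<longleftrightarrow> alternate a b w))"

definition word_representable :: "('a, 'b) pre_digraph \<Rightarrow> bool" where
  "word_representable G \<longleftrightarrow> (\<exists>w. represents w G)"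

text \<open>
  The number of occurrences is required to be positive: otherwise the empty word would
  represent complete graphs, whose representation number is conventionally 1, not 0.
\<close>

definition k_word_representable :: "nat \<Rightarrow> ('a, 'b) pre_digraph \<Rightarrow> bool" where
  "k_word_representable k G \<longleftrightarrow> k \<ge> 1 \<and>
    (\<exists>w. represents w G \<and> (\<forall>v \<in> verts G. count_list w v = k))"

definition representation_number :: "('a, 'b) pre_digraph \<Rightarrow> nat" where
  "representation_number G = (LEAST k. k_word_representable k G)"


section \<open>Comparability graphs\<close>

definition transitive_orientation :: "('a, 'b) pre_digraph \<Rightarrow> ('a \<times> 'a) set \<Rightarrow> bool" where
  "transitive_orientation G R \<longleftrightarrow>
    R \<union> R\<inverse> = arcs_ends G \<and> R \<inter> R\<inverse> = {} \<and> trans R"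

definition comparability_graph :: "('a, 'b) pre_digraph \<Rightarrow> bool" where
  "comparability_graph G \<longleftrightarrow> (\<exists>R. transitive_orientation G R)"

definition permutationally_representable :: "nat \<Rightarrow> ('a, 'b) pre_digraph \<Rightarrow> bool" where
  "permutationally_representable k G \<longleftrightarrow> k \<ge> 1 \<and>
    (\<exists>ps. length ps = k \<and> set ps \<subseteq> permutations_of_set (verts G) \<and>
          represents (concat ps) G)"

definition permutation_representation_number :: "('a, 'b) pre_digraph \<Rightarrow> nat" where
  "permutation_representation_number G = (LEAST k. permutationally_representable k G)"


section \<open>Modules\<close>

definition neighbours :: "('a, 'b) pre_digraph \<Rightarrow> 'a \<Rightarrow> 'a set" where
  "neighbours G a = {b. a \<rightarrow>\<^bsub>G\<^esub> b}"

definition graph_module :: "('a, 'b) pre_digraph \<Rightarrow> 'a set \<Rightarrow> bool" where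
  "graph_module G M \<longleftrightarrow> M \<subseteq> verts G \<and>
    (\<forall>a \<in> verts G - M. neighbours G a \<inter> M = {} \<or> M \<subseteq> neighbours G a)"

text \<open>
  The empty set satisfies the definition of a module vacuously and so has to count as
  trivial; otherwise no graph would be prime.
\<close>

definition trivial_module :: "('a, 'b) pre_digraph \<Rightarrow> 'a set \<Rightarrow> bool" where
  "trivial_module G M \<longleftrightarrow> M = {} \<or> (\<exists>v \<in> verts G. M = {v}) \<or> M = verts G"

definition prime_graph :: "('a, 'b) pre_digraph \<Rightarrow> bool" where
  "prime_graph G \<longleftrightarrow> (\<forall>M. graph_module G M \<longrightarrow> trivial_module G M)"

definition decomposable_graph :: "('a, 'b) pre_digraph \<Rightarrow> bool" where
  "decomposable_graph G \<longleftrightarrow> \<not> prime_graph G"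

definition modular_partition :: "('a, 'b) pre_digraph \<Rightarrow> 'a set set \<Rightarrow> bool" where
  "modular_partition G P \<longleftrightarrow> partition_on (verts G) P \<and> (\<forall>M \<in> P. graph_module G M)"

definition adjacent_modules :: "('a, 'b) pre_digraph \<Rightarrow> 'a set \<Rightarrow> 'a set \<Rightarrow> bool" where
  "adjacent_modules G M N \<longleftrightarrow> (\<forall>a \<in> M. \<forall>b \<in> N. a \<rightarrow>\<^bsub>G\<^esub> b)"

text \<open>The vertices of the quotient graph are the parts themselves.\<close>

definition quotient_graph ::
  "('a, 'b) pre_digraph \<Rightarrow> 'a set set \<Rightarrow> ('a set, 'a set \<times> 'a set) pre_digraph" where
  "quotient_graph G P =
    \<lparr> verts = P,
      arcs = {(M, N). M \<in> P \<and> N \<in> P \<and> M \<noteq> N \<and> adjacent_modules G M N},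
      tail = fst, head = snd \<rparr>"

end

theory Submission
  imports Defs
begin

text \<open>
  All three claims follow from one equivalence for each fixed \<open>k\<close>: if the partition is not
  \<open>{V}\<close>, then \<open>G\<close> is \<open>k\<close>-word-representable if and only if the quotient is
  \<open>k\<close>-word-representable and each part is permutationally \<open>k\<close>-representable
  (\<open>k_word_representable_iff_quotient\<close>); and the same with ``permutationally'' throughout
  (\<open>permutationally_representable_iff_quotient\<close>). As both kinds of \<open>k\<close>-representability persist
  when \<open>k\<close> grows, the smallest \<open>k\<close> for \<open>G\<close> is then the maximum of the smallest \<open>k\<close> for the
  quotient and the parts.

  From \<open>G\<close> to the pieces: the quotient is isomorphic to an induced subgraph, so a word for it is
  obtained by deleting and renaming letters. For a part \<open>M\<close>, connectedness yields an edge that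
  leaves \<open>M\<close>, and as \<open>M\<close> is a module its outer endpoint \<open>a\<close> is adjacent to all of \<open>M\<close>. A uniform
  word may be rotated so that it starts with \<open>a\<close>. Since every letter of \<open>M\<close> alternates with \<open>a\<close>,
  it occurs exactly once after each \<open>a\<close> and before the next, so that the occurrences of \<open>a\<close> cut the
  word into permutations of \<open>M\<close> (\<open>split_at_dominating_letter\<close>).

  From the pieces to \<open>G\<close>: in a \<open>k\<close>-uniform word for the quotient, replace the \<open>i\<close>-th occurrence of
  each part \<open>M\<close> by the \<open>i\<close>-th of \<open>k\<close> permutations that represent \<open>M\<close> (\<open>represents_inflate\<close>).
  Within a part one reads off these permutations, and two letters from different parts alternate
  exactly as their parts do in the given word.

  It remains to relate plain representability to some \<open>k\<close>. A word becomes uniform by repeatedly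
  appending the rarer letters in the order of their last occurrences
  (\<open>represents_append_rare_letters\<close>). A graph is a comparability graph if and only if some
  concatenation of permutations represents it, where the permutations can be taken to be all linear
  extensions of a transitive orientation.
\<close>

section \<open>Alternation in words\<close>

lemma restrict_word_simps [simp]:
  "restrict_word [] B = []"
  "restrict_word (x # w) B = (if x \<in> B then x # restrict_word w B else restrict_word w B)"
  "restrict_word (u @ v) B = restrict_word u B @ restrict_word v B"
  "set (restrict_word w B) = set w \<inter> B"
  "restrict_word (restrict_word w B) C = restrict_word w (B \<inter> C)"
  "restrict_word (remdups w) B = remdups (restrict_word w B)"
  by (auto simp: restrict_word_def remdups_filter intro: filter_cong)

lemma restrict_word_concat:
  "restrict_word (concat ps) B = concat (map (\<lambda>p. restrict_word p B) ps)"
  by (induction ps) auto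

lemma count_list_restrict_word:
  "count_list (restrict_word w B) x = (if x \<in> B then count_list w x else 0)"
  by (induction w) auto

lemma restrict_word_all: "set w \<subseteq> B \<Longrightarrow> restrict_word w B = w"
  by (auto simp: restrict_word_def intro!: filter_True)

lemma restrict_word_none: "set w \<inter> B = {} \<Longrightarrow> restrict_word w B = []"
  by (auto simp: restrict_word_def intro!: filter_False)

lemma restrict_word_single: "restrict_word w {a} = replicate (count_list w a) a"
  by (induction w) auto

lemma alternating_word_Suc:
  "alternating_word a b (Suc n) = a # alternating_word b a n"
  unfolding alternating_word_def
  by (rule nth_equalityI) (auto simp: nth_Cons simp del: upt_Suc split: nat.split)

lemma distinct_adj_if_distinct: "distinct xs \<Longrightarrow> distinct_adj xs"
  by (induction xs) (auto simp: distinct_adj_Cons)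

lemma last_remdups: "u \<noteq> [] \<Longrightarrow> last (remdups u) = last u"
  by (induction u) auto

lemma remdups_replicate: "remdups (replicate n x) = (if n = 0 then [] else [x])"
  by (induction n) auto

lemma count_list_distinct: "distinct xs \<Longrightarrow> count_list xs x = (if x \<in> set xs then 1 else 0)"
  by (induction xs) auto

lemma distinct_adj_alternating_word:
  "a \<noteq> b \<Longrightarrow> distinct_adj (alternating_word a b n)"
  unfolding alternating_word_def by (auto simp: distinct_adj_conv_nth)

lemma alternating_word_of_distinct_adj:
  assumes "distinct_adj u" "set u \<subseteq> {a, b}" "u = [] \<or> hd u = a" "a \<noteq> b"
  shows "u = alternating_word a b (length u)"
  using assms
proof (induction u arbitrary: a b)
  case Nil
  then show ?case by (simp add: alternating_word_def)
next
  case (Cons x u)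
  have "u = [] \<or> hd u = b"
    using Cons.prems by (cases u) (auto simp: distinct_adj_Cons)
  then have "u = alternating_word b a (length u)"
    using Cons.prems by (intro Cons.IH) (auto simp: distinct_adj_Cons)
  then show ?case
    using Cons.prems by (simp add: alternating_word_Suc)
qed

text \<open>Over a two-letter alphabet the form \<open>ababa\<dots>\<close> or \<open>babab\<dots>\<close> just says that no letter
  is repeated immediately. This local condition is compatible with concatenation, and replaces
  the explicit form in every argument below.\<close>

lemma alternate_iff_distinct_adj:
  assumes "a \<noteq> b"
  shows "alternate a b w \<longleftrightarrow> distinct_adj (restrict_word w {a, b})"
proof
  assume "alternate a b w"
  then show "distinct_adj (restrict_word w {a, b})"
    using assms distinct_adj_alternating_word unfolding alternate_def by metis
next
  let ?u = "restrict_word w {a, b}"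
  assume *: "distinct_adj ?u"
  have "?u = [] \<or> hd ?u \<in> set ?u" by (cases ?u) auto
  then consider "?u = [] \<or> hd ?u = a" | "?u = [] \<or> hd ?u = b" by auto
  then show "alternate a b w"
  proof cases
    case 1
    then show ?thesis
      using alternating_word_of_distinct_adj[OF *, of a b] assms unfolding alternate_def by auto
  next
    case 2
    then show ?thesis
      using alternating_word_of_distinct_adj[OF *, of b a] assms unfolding alternate_def by auto
  qed
qed

lemma represents_iff:
  "represents w G \<longleftrightarrow> set w \<subseteq> verts G \<and>
    (\<forall>a \<in> verts G. \<forall>b \<in> verts G. a \<noteq> b \<longrightarrow>
       (a \<rightarrow>\<^bsub>G\<^esub> b \<longleftrightarrow> distinct_adj (restrict_word w {a, b})))"
  unfolding represents_def by (auto simp: alternate_iff_distinct_adj)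

text \<open>In an alternating word the letter it starts with is one ahead until the other letter
  has caught up, so the last letter can be read off from the two multiplicities.\<close>

lemma count_list_distinct_adj:
  assumes "distinct_adj u" "set u \<subseteq> {a, b}" "a \<noteq> b" "u \<noteq> []" "hd u = a"
  shows "count_list u a = count_list u b + (if last u = a then 1 else 0)"
  using assms
proof (induction u arbitrary: a b)
  case Nil
  then show ?case by simp
next
  case (Cons x u)
  show ?case
  proof (cases u)
    case Nil
    then show ?thesis using Cons.prems by simp
  next
    case (Cons y v)
    then have "y = b" using Cons.prems by auto
    then have "count_list u b = count_list u a + (if last u = b then 1 else 0)"
      using Cons Cons.prems by (intro Cons.IH) auto
    moreover have "last u \<in> {a, b}"
      using Cons.prems Cons last_in_set[of u] by auto
    ultimately show ?thesis
      using Cons.prems Cons by auto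
  qed
qed

lemma last_of_rarer_letter:
  assumes "distinct_adj u" "set u \<subseteq> {a, b}" "a \<noteq> b" "count_list u a < count_list u b"
  shows "u \<noteq> [] \<and> last u = b"
proof -
  have ne: "u \<noteq> []" using assms(4) by auto
  then have "hd u \<in> {a, b}" "last u \<in> {a, b}"
    using assms(2) hd_in_set[of u] last_in_set[of u] by blast+
  moreover have "hd u = b"
    using count_list_distinct_adj[OF assms(1-3) ne] assms(4) calculation by (auto split: if_splits)
  then show ?thesis
    using count_list_distinct_adj[OF assms(1) _ _ ne, of b a] assms(2-4) ne
    by (auto simp: insert_commute split: if_splits)
qed

text \<open>If the two letters of an alternating word are equally frequent, then the word does not
  end in the letter it starts with, so it can also be read cyclically.\<close>

lemma distinct_adj_rotate:
  assumes "distinct_adj (u @ v)" "set (u @ v) \<subseteq> {a, b}" "a \<noteq> b"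
    "count_list (u @ v) a = count_list (u @ v) b"
  shows "distinct_adj (v @ u)"
proof (cases "u = [] \<or> v = []")
  case True
  then show ?thesis using assms(1) by auto
next
  case False
  have "hd (u @ v) \<in> set (u @ v)" using False by (intro hd_in_set) auto
  then have "hd (u @ v) = a \<or> hd (u @ v) = b" using assms(2) by blast
  then have "last (u @ v) \<noteq> hd (u @ v)"
    using count_list_distinct_adj[OF assms(1), of a b] count_list_distinct_adj[OF assms(1), of b a]
      assms False by (auto simp: insert_commute split: if_splits)
  then show ?thesis
    using assms(1) False by (auto simp: distinct_adj_append_iff)
qed

lemma distinct_adj_restrict_word_rotate:
  assumes "a \<noteq> b" "count_list (u @ v) a = count_list (u @ v) b"
  shows "distinct_adj (restrict_word (u @ v) {a, b}) \<longleftrightarrow>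
    distinct_adj (restrict_word (v @ u) {a, b})"
  using distinct_adj_rotate[of "restrict_word u {a, b}" "restrict_word v {a, b}" a b]
    distinct_adj_rotate[of "restrict_word v {a, b}" "restrict_word u {a, b}" a b] assms
  by (auto simp: count_list_restrict_word)

section \<open>Uniform words\<close>

text \<open>Letters that do not occur at all alternate with exactly the same letters as if they
  occurred once, at the very end.\<close>

lemma represents_surjective_word:
  assumes "represents w G" "finite (verts G)"
  obtains w' where "represents w' G" "set w' = verts G"
proof -
  obtain xs where xs: "set xs = verts G - set w" "distinct xs"
    using finite_distinct_list[of "verts G - set w"] assms(2) by auto
  have "distinct_adj (restrict_word (w @ xs) {a, b}) \<longleftrightarrow> distinct_adj (restrict_word w {a, b})"
    if ab: "a \<in> verts G" "b \<in> verts G" "a \<noteq> b" for a b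
  proof -
    have dxs: "distinct (restrict_word xs {a, b})"
      using xs by (simp add: restrict_word_def)
    have dd: "distinct_adj (restrict_word xs {a, b})"
      using dxs by (rule distinct_adj_if_distinct)
    show ?thesis
    proof (cases "restrict_word w {a, b} = [] \<or> restrict_word xs {a, b} = []")
      case True
      then show ?thesis using dd by auto
    next
      case False
      have "last (restrict_word w {a, b}) \<in> set w \<inter> {a, b}"
        using last_in_set[of "restrict_word w {a, b}"] False by simp
      moreover have "hd (restrict_word xs {a, b}) \<in> set xs \<inter> {a, b}"
        using hd_in_set[of "restrict_word xs {a, b}"] False by simp
      ultimately have "last (restrict_word w {a, b}) \<noteq> hd (restrict_word xs {a, b})"
        using xs(1) by (metis DiffD2 IntD1)
      then show ?thesis
        using dd by (simp add: distinct_adj_append_iff)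
    qed
  qed
  then have "represents (w @ xs) G"
    using assms(1) xs(1) unfolding represents_iff by auto
  moreover have "set (w @ xs) = verts G"
    using assms(1) xs(1) unfolding represents_iff by auto
  ultimately show thesis by (rule that)
qed

lemma distinct_pair_cases:
  assumes "distinct u" "set u = {a, b}" "a \<noteq> b"
  shows "u = [a, b] \<or> u = [b, a]"
proof -
  have "length u = 2" using assms distinct_card[of u] by simp
  then obtain x y where "u = [x, y]" by (auto simp: length_Suc_conv numeral_2_eq_2)
  then show ?thesis using assms by (auto simp: doubleton_eq_iff)
qed

lemma remdups_distinct_adj_append:
  assumes "distinct_adj u" "set u = {a, b}" "a \<noteq> b"
  shows "distinct_adj (u @ remdups u)"
proof -
  have ne: "u \<noteq> []" using assms(2) by auto
  have l: "last (remdups u) = last u" using ne by (rule last_remdups)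
  have d: "distinct_adj (remdups u)" by (rule distinct_adj_if_distinct) simp
  have "remdups u = [a, b] \<or> remdups u = [b, a]"
    using assms(2,3) by (intro distinct_pair_cases) auto
  then show ?thesis
    using assms(1,3) l d ne by (auto simp: distinct_adj_append_iff)
qed

text \<open>The extension step that makes words uniform: append once more each letter that occurs
  fewer than \<open>m\<close> times, in the order of their last occurrences (which is what \<open>remdups\<close> keeps).
  Two appended letters that alternated so far continue to alternate because of this order. If
  only one letter of an alternating pair is appended, then it is the rarer one, so the word
  restricted to that pair ends in the other letter.\<close>

lemma represents_append_rare_letters:
  assumes "represents w G" "set w = verts G"
  shows "represents (w @ restrict_word (remdups w) {v. count_list w v < m}) G"
proof -
  let ?S = "{v. count_list w v < m}"
  let ?w' = "w @ restrict_word (remdups w) ?S"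
  have one: "distinct_adj (restrict_word ?w' {a, b})"
    if "distinct_adj (restrict_word w {a, b})" "a \<in> set w" "b \<in> set w" "a \<noteq> b"
      "a \<in> ?S" "b \<notin> ?S" for a b
  proof -
    have "count_list w a < count_list w b" using that by simp
    then have l: "restrict_word w {a, b} \<noteq> [] \<and> last (restrict_word w {a, b}) = b"
      using that by (intro last_of_rarer_letter) (auto simp: count_list_restrict_word)
    have "?S \<inter> {a, b} = {a}" using that by auto
    moreover have "remdups (restrict_word w {a}) = [a]"
      using \<open>a \<in> set w\<close> count_list_0_iff[of w a]
      by (simp add: restrict_word_single remdups_replicate)
    ultimately show ?thesis
      using that l by (simp add: distinct_adj_append_iff)
  qed
  have "distinct_adj (restrict_word ?w' {a, b})"
    if d: "distinct_adj (restrict_word w {a, b})" and ab: "a \<in> set w" "b \<in> set w" "a \<noteq> b" for a b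
  proof -
    consider "a \<in> ?S" "b \<in> ?S" | "a \<in> ?S" "b \<notin> ?S" | "b \<in> ?S" "a \<notin> ?S" | "a \<notin> ?S" "b \<notin> ?S"
      by blast
    then show ?thesis
    proof cases
      case 1
      then have "?S \<inter> {a, b} = {a, b}" by auto
      then show ?thesis
        using remdups_distinct_adj_append[OF d, of a b] ab by simp
    next
      case 2
      then show ?thesis using one d ab by blast
    next
      case 3
      then show ?thesis using one[of b a] d ab by (simp add: insert_commute)
    next
      case 4
      then have "?S \<inter> {a, b} = {}" by auto
      then show ?thesis using d restrict_word_none[of w "{}"] by simp
    qed
  qed
  then have "distinct_adj (restrict_word ?w' {a, b}) \<longleftrightarrow> distinct_adj (restrict_word w {a, b})"
    if "a \<in> verts G" "b \<in> verts G" "a \<noteq> b" for a b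
    using that assms(2) by (auto dest: distinct_adj_appendD1)
  then show ?thesis
    using assms unfolding represents_iff by auto
qed

text \<open>Each extension step raises the multiplicities that are still below \<open>m\<close> and leaves the others
  alone, so after finitely many steps all of them equal \<open>m\<close>. This yields uniform words from
  arbitrary ones as well as \<open>m\<close>-uniform words from \<open>k\<close>-uniform ones for \<open>k \<le> m\<close>.\<close>

lemma represents_uniform_extension:
  assumes "represents w G" "set w = verts G" "\<forall>v \<in> verts G. count_list w v \<le> m"
  obtains w' where "represents w' G" "\<forall>v \<in> verts G. count_list w' v = m"
proof -
  have "\<exists>w'. represents w' G \<and> (\<forall>v \<in> verts G. count_list w' v = m)"
    if "\<forall>v \<in> verts G. m \<le> count_list w v + j" for j
    using assms that
  proof (induction j arbitrary: w)
    case 0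
    then show ?case by (intro exI[of _ w]) (auto intro: le_antisym)
  next
    case (Suc j)
    let ?w = "w @ restrict_word (remdups w) {v. count_list w v < m}"
    have "count_list (remdups w) v = 1" if "v \<in> verts G" for v
      using that Suc.prems(2) by (simp add: count_list_distinct)
    then have c: "count_list ?w v = (if count_list w v < m then Suc (count_list w v) else count_list w v)"
      if "v \<in> verts G" for v
      using that by (simp only: count_list_append count_list_restrict_word) auto
    show ?case
    proof (rule Suc.IH)
      show "represents ?w G" by (rule represents_append_rare_letters[OF Suc.prems(1,2)])
      show "set ?w = verts G" using Suc.prems(2) by auto
      show "\<forall>v\<in>verts G. count_list ?w v \<le> m" using Suc.prems(3) c by auto
      show "\<forall>v\<in>verts G. m \<le> count_list ?w v + j" using Suc.prems(4) c by fastforce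
    qed
  qed
  from this[of m] that show thesis by auto
qed

lemma k_word_representable_mono:
  assumes "k_word_representable k G" "k \<le> m"
  shows "k_word_representable m G"
proof -
  from assms(1) obtain w where w: "k \<ge> 1" "represents w G" "\<forall>v \<in> verts G. count_list w v = k"
    unfolding k_word_representable_def by auto
  have "v \<in> set w" if "v \<in> verts G" for v
    using that w(1,3) count_list_0_iff[of w v] by auto
  then have "set w = verts G" using w(2) unfolding represents_iff by auto
  then show ?thesis
    using represents_uniform_extension[OF w(2), of m] w assms(2)
    unfolding k_word_representable_def by (metis le_trans)
qed

lemma word_representable_iff_k_word_representable:
  assumes "finite (verts G)"
  shows "word_representable G \<longleftrightarrow> (\<exists>k. k_word_representable k G)"
proof
  assume "word_representable G"
  then obtain w where w: "represents w G" "set w = verts G"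
    using represents_surjective_word assms unfolding word_representable_def by metis
  have "\<forall>v \<in> verts G. count_list w v \<le> Suc (length w)"
    by (simp add: count_le_length le_SucI)
  from represents_uniform_extension[OF w this] show "\<exists>k. k_word_representable k G"
    unfolding k_word_representable_def by (metis One_nat_def Suc_le_mono le0)
qed (auto simp: word_representable_def k_word_representable_def)

text \<open>Monotonicity in \<open>k\<close> turns the least number \<open>k\<close> into a threshold. Formulas for representation
  numbers thereby reduce to equivalences that hold for each \<open>k\<close> separately.\<close>

lemma representation_number_le_iff:
  assumes "finite (verts G)" "word_representable G"
  shows "representation_number G \<le> k \<longleftrightarrow> k_word_representable k G"
proof
  assume "representation_number G \<le> k"
  moreover have "k_word_representable (representation_number G) G"
    using assms word_representable_iff_k_word_representable[OF assms(1)]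
    unfolding representation_number_def by (metis LeastI)
  ultimately show "k_word_representable k G" by (rule k_word_representable_mono[rotated])
qed (simp add: representation_number_def Least_le)

section \<open>Concatenated permutations\<close>

lemma restrict_word_permutation:
  assumes "p \<in> permutations_of_set V" "a \<in> V" "b \<in> V" "a \<noteq> b"
  shows "restrict_word p {a, b} = [a, b] \<or> restrict_word p {a, b} = [b, a]"
  using assms
  by (intro distinct_pair_cases)
     (auto simp: restrict_word_def permutations_of_set_def)

lemma distinct_adj_concat_pairs:
  assumes "a \<noteq> b" "set qs \<subseteq> {[a, b], [b, a]}"
  shows "distinct_adj (concat qs) \<longleftrightarrow> set qs \<subseteq> {[a, b]} \<or> set qs \<subseteq> {[b, a]}"
  using assms(2)
proof (induction qs)
  case Nil
  then show ?case by simp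
next
  case (Cons q qs)
  then show ?case
    using assms(1) by (cases qs) (auto simp: distinct_adj_append_iff)
qed

text \<open>Two letters alternate in a concatenation of permutations exactly if all the permutations
  put them in the same order: where the order changes, one of them is repeated.\<close>

lemma distinct_adj_permutations_iff:
  assumes "set ps \<subseteq> permutations_of_set V" "a \<in> V" "b \<in> V" "a \<noteq> b"
  shows "distinct_adj (restrict_word (concat ps) {a, b}) \<longleftrightarrow>
    (\<forall>p \<in> set ps. restrict_word p {a, b} = [a, b]) \<or>
    (\<forall>p \<in> set ps. restrict_word p {a, b} = [b, a])"
proof -
  have "set (map (\<lambda>p. restrict_word p {a, b}) ps) \<subseteq> {[a, b], [b, a]}"
    using assms restrict_word_permutation[of _ V a b] by auto
  from distinct_adj_concat_pairs[OF assms(4) this] show ?thesis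
    unfolding restrict_word_concat by auto
qed

lemma set_concat_permutations:
  "set ps \<subseteq> permutations_of_set V \<Longrightarrow> set (concat ps) \<subseteq> V"
  by (auto simp: permutations_of_set_def)

lemma represents_permutations_iff:
  assumes "set ps \<subseteq> permutations_of_set (verts G)"
  shows "represents (concat ps) G \<longleftrightarrow>
    (\<forall>a \<in> verts G. \<forall>b \<in> verts G. a \<noteq> b \<longrightarrow> (a \<rightarrow>\<^bsub>G\<^esub> b \<longleftrightarrow>
      (\<forall>p \<in> set ps. restrict_word p {a, b} = [a, b]) \<or>
      (\<forall>p \<in> set ps. restrict_word p {a, b} = [b, a])))"
  using set_concat_permutations[OF assms] unfolding represents_iff
  by (simp add: distinct_adj_permutations_iff[OF assms] cong: ball_cong)

text \<open>By the criterion above only the set of permutations matters, so any of them may be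
  repeated.\<close>

lemma permutationally_representable_mono:
  assumes "permutationally_representable k G" "k \<le> m"
  shows "permutationally_representable m G"
proof -
  from assms(1) obtain ps where ps: "k \<ge> 1" "length ps = k"
      "set ps \<subseteq> permutations_of_set (verts G)" "represents (concat ps) G"
    unfolding permutationally_representable_def by auto
  define qs where "qs = ps @ replicate (m - k) (hd ps)"
  have "set qs = set ps"
    using ps(1,2) by (cases ps) (auto simp: qs_def)
  then have "set qs \<subseteq> permutations_of_set (verts G)" "represents (concat qs) G"
    using ps(3,4) by (simp_all add: represents_permutations_iff)
  moreover have "length qs = m" using ps(2) assms(2) by (simp add: qs_def)
  ultimately show ?thesis
    using ps(1) assms(2) unfolding permutationally_representable_def by auto
qed

section \<open>Linear extensions and comparability graphs\<close>

definition linear_extension :: "('a \<times> 'a) set \<Rightarrow> 'a set \<Rightarrow> 'a list \<Rightarrow> bool" where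
  "linear_extension R V p \<longleftrightarrow> p \<in> permutations_of_set V \<and>
    (\<forall>a \<in> V. \<forall>b \<in> V. (a, b) \<in> R \<longrightarrow> restrict_word p {a, b} = [a, b])"

lemma restrict_word_separated:
  assumes "distinct (u @ v)" "a \<in> set u" "b \<in> set v"
  shows "restrict_word (u @ v) {a, b} = [a, b]"
proof -
  have "b \<notin> set u" "a \<notin> set v" "a \<noteq> b" using assms by auto
  then have "restrict_word u {a, b} = restrict_word u {a}"
    "restrict_word v {a, b} = restrict_word v {b}"
    unfolding restrict_word_def by (auto intro!: filter_cong)
  then show ?thesis
    using assms by (simp add: restrict_word_single count_list_distinct)
qed

text \<open>Both forms of ``\<open>a\<close> precedes \<open>b\<close> in \<open>p\<close>'' are needed: the restriction is what alternation
  refers to, and the factorization is what makes transitivity visible.\<close>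

lemma restrict_word_eq_pair_iff:
  assumes "distinct p" "a \<noteq> b"
  shows "restrict_word p {a, b} = [a, b] \<longleftrightarrow> (\<exists>u v. p = u @ v \<and> a \<in> set u \<and> b \<in> set v)"
proof
  assume *: "restrict_word p {a, b} = [a, b]"
  then have "set p \<inter> {a, b} = {a, b}" by (metis restrict_word_simps(4) list.set(1,2))
  then have ab: "a \<in> set p" "b \<in> set p" by auto
  from ab(1) obtain u v where p: "p = u @ a # v" by (meson split_list)
  have "b \<notin> set u"
  proof
    assume "b \<in> set u"
    then have "restrict_word (u @ a # v) {b, a} = [b, a]"
      using assms(1) p by (intro restrict_word_separated) auto
    then show False using * p assms(2) by (simp only: insert_commute) simp
  qed
  then have "b \<in> set v" using ab(2) p assms(2) by auto
  then show "\<exists>u v. p = u @ v \<and> a \<in> set u \<and> b \<in> set v"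
    using p by (intro exI[of _ "u @ [a]"] exI[of _ v]) auto
next
  assume "\<exists>u v. p = u @ v \<and> a \<in> set u \<and> b \<in> set v"
  then obtain u v where "p = u @ v" "a \<in> set u" "b \<in> set v" by blast
  then show "restrict_word p {a, b} = [a, b]"
    using assms(1) restrict_word_separated[of u v a b] by simp
qed

lemma restrict_word_pair_trans:
  assumes "distinct p" "restrict_word p {a, b} = [a, b]" "restrict_word p {b, c} = [b, c]"
    "a \<noteq> b" "b \<noteq> c"
  shows "a \<noteq> c \<and> restrict_word p {a, c} = [a, c]"
proof -
  obtain u v where uv: "p = u @ v" "a \<in> set u" "b \<in> set v"
    using assms restrict_word_eq_pair_iff by metis
  obtain u' v' where uv': "p = u' @ v'" "b \<in> set u'" "c \<in> set v'"
    using assms restrict_word_eq_pair_iff by metis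
  have "b \<notin> set u" using assms(1) uv by auto
  then obtain t where "v = t @ v'"
    using uv uv' by (auto simp: append_eq_append_conv2)
  then have "c \<in> set v" using uv'(3) by simp
  then show ?thesis
    using assms(1) uv restrict_word_separated[of u v a c] by auto
qed

lemma linear_extension_exists:
  assumes "finite V" "trans R" "\<And>x. (x, x) \<notin> R"
  shows "\<exists>p. linear_extension R V p"
  using assms(1)
proof (induction V rule: finite_psubset_induct)
  case (psubset V)
  show ?case
  proof (cases "V = {}")
    case True
    then show ?thesis by (auto simp: linear_extension_def)
  next
    case False
    let ?Q = "R \<inter> V \<times> V"
    have "trans ?Q" using assms(2) by (auto simp: trans_def)
    then have "acyclic ?Q" using assms(3) by (simp add: acyclic_def)
    moreover have "finite ?Q" using psubset.hyps by simp
    ultimately have "wf ?Q" by (simp add: finite_acyclic_wf)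
    then obtain m where m: "m \<in> V" "\<And>x. (x, m) \<in> ?Q \<Longrightarrow> x \<notin> V"
      using False by (meson wfE_min all_not_in_conv)
    then obtain p where p: "linear_extension R (V - {m}) p"
      using psubset.IH[of "V - {m}"] by blast
    then have dp: "distinct ([m] @ p)" "set p = V - {m}"
      by (auto simp: linear_extension_def permutations_of_set_def)
    have "restrict_word (m # p) {a, b} = [a, b]" if "a \<in> V" "b \<in> V" "(a, b) \<in> R" for a b
    proof -
      have "b \<noteq> m" using m(2)[of a] m(1) that by blast
      show ?thesis
      proof (cases "a = m")
        case True
        then show ?thesis
          using restrict_word_separated[OF dp(1), of m b] dp(2) that \<open>b \<noteq> m\<close> by auto
      next
        case False
        then show ?thesis
          using p that \<open>b \<noteq> m\<close> by (auto simp: linear_extension_def)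
      qed
    qed
    then have "linear_extension R V (m # p)"
      using dp m(1) by (auto simp: linear_extension_def permutations_of_set_def)
    then show ?thesis ..
  qed
qed

text \<open>The elements weakly below \<open>a\<close> form a down-set. Listing it before its complement respects
  the order, and puts \<open>a\<close> before any \<open>b\<close> that is not below \<open>a\<close>.\<close>

lemma linear_extension_separating:
  assumes "finite V" "trans R" "\<And>x. (x, x) \<notin> R" "a \<in> V" "b \<in> V" "a \<noteq> b" "(b, a) \<notin> R"
  shows "\<exists>p. linear_extension R V p \<and> restrict_word p {a, b} = [a, b]"
proof -
  define D where "D = {x \<in> V. x = a \<or> (x, a) \<in> R}"
  obtain p where p: "linear_extension R D p"
    using linear_extension_exists[of D R] assms(1-3) by (auto simp: D_def)
  obtain q where q: "linear_extension R (V - D) q"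
    using linear_extension_exists[of "V - D" R] assms(1-3) by auto
  have sets: "set p = D" "set q = V - D" and d: "distinct (p @ q)"
    using p q by (auto simp: linear_extension_def permutations_of_set_def)
  have "restrict_word (p @ q) {x, y} = [x, y]" if xy: "x \<in> V" "y \<in> V" "(x, y) \<in> R" for x y
  proof -
    consider "x \<in> D" "y \<in> D" | "x \<in> D" "y \<notin> D" | "x \<notin> D" "y \<notin> D"
      using xy assms(2) unfolding D_def by (auto dest: transD)
    then show ?thesis
    proof cases
      case 1
      then have "restrict_word q {x, y} = []" using sets by (intro restrict_word_none) auto
      then show ?thesis using 1 p xy by (auto simp: linear_extension_def)
    next
      case 2
      then show ?thesis using sets d xy by (intro restrict_word_separated) auto
    next
      case 3
      then have "restrict_word p {x, y} = []" using sets by (intro restrict_word_none) auto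
      then show ?thesis using 3 q xy by (auto simp: linear_extension_def)
    qed
  qed
  moreover have "D \<subseteq> V" "a \<in> D" "b \<notin> D" using assms(4-7) by (auto simp: D_def)
  then have "set (p @ q) = V" "restrict_word (p @ q) {a, b} = [a, b]"
    using sets assms(5) d restrict_word_separated[of p q a b] by auto
  ultimately have "linear_extension R V (p @ q)" "restrict_word (p @ q) {a, b} = [a, b]"
    using d by (auto simp: linear_extension_def permutations_of_set_def)
  then show ?thesis by blast
qed

text \<open>A transitive orientation is a strict partial order whose comparable pairs are the edges.
  The word that lists all its linear extensions has each comparable pair always in the same order,
  whereas each incomparable pair occurs in both orders.\<close>

lemma permutationally_representable_if_comparability_graph:
  assumes "finite (verts G)" "comparability_graph G"
  shows "\<exists>k. permutationally_representable k G"
proof -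
  obtain R where R: "R \<union> R\<inverse> = arcs_ends G" "R \<inter> R\<inverse> = {}" "trans R"
    using assms(2) unfolding comparability_graph_def transitive_orientation_def by auto
  have irr: "\<And>x. (x, x) \<notin> R" using R(2) by auto
  have "finite {p. linear_extension R (verts G) p}"
    by (rule finite_subset[of _ "permutations_of_set (verts G)"])
       (auto simp: linear_extension_def)
  then obtain ps where ps: "set ps = {p. linear_extension R (verts G) p}"
    using finite_list by auto
  have perms: "set ps \<subseteq> permutations_of_set (verts G)"
    using ps by (auto simp: linear_extension_def)
  have "ps \<noteq> []"
    using linear_extension_exists[OF assms(1) R(3) irr] ps by auto
  moreover have "represents (concat ps) G"
    unfolding represents_permutations_iff[OF perms]
  proof (intro ballI impI)
    fix a b assume ab: "a \<in> verts G" "b \<in> verts G" "a \<noteq> b"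
    have adj: "a \<rightarrow>\<^bsub>G\<^esub> b \<longleftrightarrow> (a, b) \<in> R \<or> (b, a) \<in> R"
      using R(1) by blast
    show "a \<rightarrow>\<^bsub>G\<^esub> b \<longleftrightarrow> (\<forall>p \<in> set ps. restrict_word p {a, b} = [a, b]) \<or>
      (\<forall>p \<in> set ps. restrict_word p {a, b} = [b, a])"
    proof
      assume "a \<rightarrow>\<^bsub>G\<^esub> b"
      moreover have ext: "\<forall>p \<in> set ps. restrict_word p {x, y} = [x, y]"
        if "(x, y) \<in> R" "x \<in> verts G" "y \<in> verts G" for x y
        using ps that unfolding linear_extension_def by blast
      ultimately show "(\<forall>p \<in> set ps. restrict_word p {a, b} = [a, b]) \<or>
          (\<forall>p \<in> set ps. restrict_word p {a, b} = [b, a])"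
        using adj ext[of a b] ext[of b a] ab(1,2) insert_commute[of a b "{}"] by auto
    next
      assume same: "(\<forall>p \<in> set ps. restrict_word p {a, b} = [a, b]) \<or>
          (\<forall>p \<in> set ps. restrict_word p {a, b} = [b, a])"
      show "a \<rightarrow>\<^bsub>G\<^esub> b"
      proof (rule ccontr)
        assume "\<not> a \<rightarrow>\<^bsub>G\<^esub> b"
        then have n: "(a, b) \<notin> R" "(b, a) \<notin> R" using adj by auto
        obtain p where "p \<in> set ps" "restrict_word p {a, b} = [a, b]"
          using linear_extension_separating[OF assms(1) R(3) irr ab n(2)] ps by auto
        moreover obtain q where "q \<in> set ps" "restrict_word q {a, b} = [b, a]"
          using linear_extension_separating[OF assms(1) R(3) irr ab(2,1) ab(3)[symmetric] n(1)] ps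
          by (auto simp: insert_commute)
        ultimately show False using same ab(3) by auto
      qed
    qed
  qed
  ultimately have "permutationally_representable (length ps) G"
    using perms unfolding permutationally_representable_def by (auto simp: Suc_le_eq)
  then show ?thesis ..
qed

text \<open>Conversely, coming first in all of the permutations is a transitive relation.\<close>

lemma comparability_graph_if_permutationally_representable:
  assumes "permutationally_representable k G"
    and wf: "\<And>a b. a \<rightarrow>\<^bsub>G\<^esub> b \<Longrightarrow> a \<in> verts G \<and> b \<in> verts G \<and> a \<noteq> b"
  shows "comparability_graph G"
proof -
  from assms(1) obtain ps where k: "k \<ge> 1" "length ps = k"
    and perms: "set ps \<subseteq> permutations_of_set (verts G)" and rep: "represents (concat ps) G"
    unfolding permutationally_representable_def by auto
  define R where "R = {(a, b). a \<in> verts G \<and> b \<in> verts G \<and> a \<noteq> b \<and>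
    (\<forall>p \<in> set ps. restrict_word p {a, b} = [a, b])}"
  have "hd ps \<in> set ps" using k by (cases ps) auto
  then have "R \<inter> R\<inverse> = {}"
    unfolding R_def by (auto simp: insert_commute)
  moreover have "trans R"
  proof (rule transI)
    fix a b c assume ab: "(a, b) \<in> R" and bc: "(b, c) \<in> R"
    have "a \<noteq> c \<and> restrict_word p {a, c} = [a, c]" if "p \<in> set ps" for p
      using that ab bc perms unfolding R_def
      by (intro restrict_word_pair_trans[of p a b c]) (auto simp: permutations_of_set_def)
    then show "(a, c) \<in> R"
      using ab bc \<open>hd ps \<in> set ps\<close> unfolding R_def by auto
  qed
  moreover have "R \<union> R\<inverse> = arcs_ends G"
  proof -
    have "(a, b) \<in> R \<union> R\<inverse> \<longleftrightarrow> a \<rightarrow>\<^bsub>G\<^esub> b" for a b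
      using rep wf[of a b] unfolding represents_permutations_iff[OF perms] R_def
      by (auto simp: insert_commute)
    then show ?thesis by auto
  qed
  ultimately show ?thesis
    unfolding comparability_graph_def transitive_orientation_def by blast
qed

lemma permutation_representation_number_le_iff:
  assumes "permutationally_representable m G"
  shows "permutation_representation_number G \<le> k \<longleftrightarrow> permutationally_representable k G"
proof
  assume "permutation_representation_number G \<le> k"
  moreover have "permutationally_representable (permutation_representation_number G) G"
    using assms unfolding permutation_representation_number_def by (rule LeastI)
  ultimately show "permutationally_representable k G"
    by (rule permutationally_representable_mono[rotated])
qed (simp add: permutation_representation_number_def Least_le)

section \<open>Induced subgraphs\<close>

text \<open>Embeddings are used instead of vertex subsets because the quotient graph, whose vertices are
  sets of vertices of \<open>G\<close>, has to be treated as an induced subgraph of \<open>G\<close>.\<close>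

definition induced_embedding ::
  "('c \<Rightarrow> 'a) \<Rightarrow> ('c, 'd) pre_digraph \<Rightarrow> ('a, 'b) pre_digraph \<Rightarrow> bool" where
  "induced_embedding f H G \<longleftrightarrow> inj_on f (verts H) \<and> f ` verts H \<subseteq> verts G \<and>
    (\<forall>a \<in> verts H. \<forall>b \<in> verts H. a \<noteq> b \<longrightarrow> (a \<rightarrow>\<^bsub>H\<^esub> b \<longleftrightarrow> f a \<rightarrow>\<^bsub>G\<^esub> f b))"

definition pull_back_word :: "('c \<Rightarrow> 'a) \<Rightarrow> 'c set \<Rightarrow> 'a list \<Rightarrow> 'c list" where
  "pull_back_word f V w = map (inv_into V f) (restrict_word w (f ` V))"

lemma restrict_pull_back_word:
  assumes "inj_on f V" "B \<subseteq> V"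
  shows "restrict_word (pull_back_word f V w) B =
    map (inv_into V f) (restrict_word w (f ` B))"
  using assms by (induction w) (auto simp: pull_back_word_def inj_on_image_mem_iff)

lemma count_list_eq_length: "count_list w a = length (restrict_word w {a})"
  by (simp add: restrict_word_single)

lemma count_list_pull_back_word:
  assumes "inj_on f V" "a \<in> V"
  shows "count_list (pull_back_word f V w) a = count_list w (f a)"
  using assms restrict_pull_back_word[of f V "{a}" w] by (simp add: count_list_eq_length)

lemma represents_pull_back_word:
  assumes "induced_embedding f H G" "represents w G"
  shows "represents (pull_back_word f (verts H) w) H"
proof -
  let ?V = "verts H"
  have inj: "inj_on f ?V" and sub: "f ` ?V \<subseteq> verts G"
    and adj: "\<And>a b. \<lbrakk>a \<in> ?V; b \<in> ?V; a \<noteq> b\<rbrakk> \<Longrightarrow> a \<rightarrow>\<^bsub>H\<^esub> b \<longleftrightarrow> f a \<rightarrow>\<^bsub>G\<^esub> f b"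
    using assms(1) unfolding induced_embedding_def by auto
  have "distinct_adj (restrict_word (pull_back_word f ?V w) {a, b}) \<longleftrightarrow>
      distinct_adj (restrict_word w {f a, f b})" if "a \<in> ?V" "b \<in> ?V" for a b
  proof -
    have "inj_on (inv_into ?V f) (set (restrict_word w {f a, f b}))"
      by (rule inj_on_subset[OF inj_on_inv_into[of "f ` ?V" f ?V]]) (use that in auto)
    then show ?thesis
      using that inj by (simp add: restrict_pull_back_word distinct_adj_map_iff)
  qed
  moreover have "f a \<rightarrow>\<^bsub>G\<^esub> f b \<longleftrightarrow> distinct_adj (restrict_word w {f a, f b})"
    if "a \<in> ?V" "b \<in> ?V" "a \<noteq> b" for a b
  proof -
    have "f a \<in> verts G" "f b \<in> verts G" "f a \<noteq> f b"
      using that sub inj by (auto simp: inj_on_eq_iff)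
    then show ?thesis using assms(2) unfolding represents_iff by blast
  qed
  moreover have "set (pull_back_word f ?V w) \<subseteq> ?V"
    by (auto simp: pull_back_word_def inv_into_into)
  ultimately show ?thesis
    unfolding represents_iff using adj by simp
qed

lemma k_word_representable_induced:
  assumes "induced_embedding f H G" "k_word_representable k G"
  shows "k_word_representable k H"
proof -
  obtain w where "k \<ge> 1" "represents w G" "\<forall>v \<in> verts G. count_list w v = k"
    using assms(2) unfolding k_word_representable_def by auto
  moreover have "inj_on f (verts H)" "f ` verts H \<subseteq> verts G"
    using assms(1) unfolding induced_embedding_def by auto
  ultimately show ?thesis
    using represents_pull_back_word[OF assms(1)] unfolding k_word_representable_def
    by (intro conjI exI[of _ "pull_back_word f (verts H) w"])
       (auto simp: count_list_pull_back_word)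
qed

lemma permutationally_representable_induced:
  assumes "induced_embedding f H G" "permutationally_representable k G"
  shows "permutationally_representable k H"
proof -
  let ?pb = "pull_back_word f (verts H)"
  obtain ps where ps: "k \<ge> 1" "length ps = k"
      "set ps \<subseteq> permutations_of_set (verts G)" "represents (concat ps) G"
    using assms(2) unfolding permutationally_representable_def by auto
  have inj: "inj_on f (verts H)" and sub: "f ` verts H \<subseteq> verts G"
    using assms(1) unfolding induced_embedding_def by auto
  have "?pb p \<in> permutations_of_set (verts H)" if "p \<in> permutations_of_set (verts G)" for p
  proof -
    have "set p = verts G" "distinct p" using that by (auto simp: permutations_of_set_def)
    then have "set (restrict_word p (f ` verts H)) = f ` verts H"
      "distinct (restrict_word p (f ` verts H))"
      using sub by (auto simp: restrict_word_def)
    then show ?thesis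
      using inj by (auto simp: pull_back_word_def permutations_of_set_def distinct_map
          inj_on_inv_into image_image)
  qed
  moreover have "?pb (concat ps) = concat (map ?pb ps)"
    by (induction ps) (auto simp: pull_back_word_def)
  ultimately show ?thesis
    using ps represents_pull_back_word[OF assms(1) ps(4)]
    unfolding permutationally_representable_def
    by (intro conjI exI[of _ "map ?pb ps"]) auto
qed

lemma arcs_ends_induce_subgraph: "arcs_ends (G \<restriction> M) = arcs_ends G \<inter> M \<times> M"
  by (auto simp: arcs_ends_conv)

lemma induced_embedding_induce_subgraph:
  "M \<subseteq> verts G \<Longrightarrow> induced_embedding id (G \<restriction> M) G"
  by (auto simp: induced_embedding_def arcs_ends_induce_subgraph)

section \<open>Parts dominated by a vertex\<close>

lemma restrict_word_Int_set: "restrict_word w B = restrict_word w (B \<inter> set w)"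
  unfolding restrict_word_def by (rule filter_cong) auto

lemma permutations_of_set_countI:
  assumes "set u \<subseteq> M" "\<forall>x \<in> M. count_list u x = 1"
  shows "u \<in> permutations_of_set M"
proof -
  have "distinct u"
    using assms
  proof (induction u arbitrary: M)
    case (Cons x u)
    have "\<forall>y \<in> M - {x}. count_list u y = 1" "count_list u x = 0"
      using Cons.prems by (auto split: if_splits)
    moreover have "x \<notin> set u" using calculation(2) by (simp add: count_list_0_iff)
    ultimately show ?case
      using Cons.prems(1) by (auto intro!: Cons.IH[of "M - {x}"])
  qed simp
  moreover have "M \<subseteq> set u"
    using assms(2) count_list_0_iff[of u] by (metis subsetI zero_neq_one)
  ultimately show ?thesis using assms(1) by (auto simp: permutations_of_set_def)
qed

lemma distinct_adj_replicate: "distinct_adj (replicate n x) \<longleftrightarrow> n \<le> 1"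
  by (cases n rule: nat.exhaust; cases "n - 1") (auto simp: distinct_adj_Cons)

text \<open>If every letter of \<open>M\<close> alternates with \<open>a\<close>, then between two consecutive occurrences of
  \<open>a\<close> each of them occurs exactly once. A uniform word that starts with \<open>a\<close> is therefore cut
  by the occurrences of \<open>a\<close> into permutations of \<open>M\<close>.\<close>

lemma split_at_dominating_letter:
  assumes "w = [] \<or> hd w = a" "a \<notin> M" "set w \<subseteq> insert a M" "count_list w a = k"
    "\<forall>x \<in> M. count_list w x = k \<and> distinct_adj (restrict_word w {a, x})"
  shows "\<exists>ps. length ps = k \<and> set ps \<subseteq> permutations_of_set M \<and> restrict_word w M = concat ps"
  using assms
proof (induction k arbitrary: w)
  case 0
  have "w = []"
  proof (rule ccontr)
    assume "w \<noteq> []"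
    then have "hd w \<in> set w" by simp
    then show False using 0 count_list_0_iff[of w "hd w"] by auto
  qed
  then show ?case by simp
next
  case (Suc k)
  then have "w \<noteq> []" by auto
  then obtain v where v: "w = a # v" using Suc.prems(1) by (cases w) auto
  define u where "u = takeWhile (\<lambda>x. x \<noteq> a) v"
  define w' where "w' = dropWhile (\<lambda>x. x \<noteq> a) v"
  have w: "w = a # u @ w'" by (simp add: v u_def w'_def)
  have au: "a \<notin> set u" by (auto simp: u_def dest: set_takeWhileD)
  have w': "w' = [] \<or> hd w' = a"
    using hd_dropWhile[of "\<lambda>x. x \<noteq> a" v] by (auto simp: w'_def)
  have uM: "set u \<subseteq> M" using Suc.prems(3) au w by auto
  have ca: "count_list w' a = k" using Suc.prems(4) w au by simp
  have one: "count_list u x = 1 \<and> distinct_adj (restrict_word w' {a, x})" if x: "x \<in> M" for x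
  proof -
    have xa: "x \<noteq> a" using x Suc.prems(2) by auto
    have "{a, x} \<inter> set u = {x} \<inter> set u" using au by auto
    then have ru: "restrict_word u {a, x} = replicate (count_list u x) x"
      by (metis restrict_word_Int_set restrict_word_single)
    have d: "distinct_adj (a # replicate (count_list u x) x @ restrict_word w' {a, x})"
      using Suc.prems(5) x ru w by auto
    then have d': "distinct_adj (replicate (count_list u x) x)" "distinct_adj (restrict_word w' {a, x})"
      by (auto dest: distinct_adj_ConsD)
    have "count_list u x \<noteq> 0"
    proof
      assume 0: "count_list u x = 0"
      show False
      proof (cases w')
        case Nil
        then show False using 0 Suc.prems(5) x w xa by auto
      next
        case (Cons y t)
        then have "y = a" using w' by simp
        then show False using d 0 Cons by simp
      qed
    qed
    then show ?thesis using d' by (simp add: distinct_adj_replicate)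
  qed
  then have "u \<in> permutations_of_set M"
    using uM by (intro permutations_of_set_countI) auto
  moreover have "\<exists>ps. length ps = k \<and> set ps \<subseteq> permutations_of_set M \<and> restrict_word w' M = concat ps"
  proof (rule Suc.IH[OF w' Suc.prems(2) _ ca])
    show "set w' \<subseteq> insert a M" using Suc.prems(3) w by auto
    have "count_list w' x = k" if "x \<in> M" for x
    proof -
      have "x \<noteq> a" "count_list w x = Suc k" using that Suc.prems(2,5) by auto
      then show ?thesis using one[OF that] w by simp
    qed
    then show "\<forall>x \<in> M. count_list w' x = k \<and> distinct_adj (restrict_word w' {a, x})"
      using one by blast
  qed
  then obtain ps where ps: "length ps = k" "set ps \<subseteq> permutations_of_set M"
      "restrict_word w' M = concat ps"
    by blast
  moreover have "restrict_word w M = u @ restrict_word w' M"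
    using w uM Suc.prems(2) by (simp add: restrict_word_all)
  ultimately show ?case
    by (intro exI[of _ "u # ps"]) auto
qed

text \<open>This is the reason why the parts, unlike the quotient, have to be comparability graphs:
  a vertex adjacent to all of \<open>M\<close> forces permutations on \<open>M\<close>, one for each of its own
  occurrences.\<close>

lemma permutationally_representable_if_dominated:
  assumes "k_word_representable k G" "a \<in> verts G" "M \<subseteq> verts G" "a \<notin> M"
    and dom: "\<forall>x \<in> M. a \<rightarrow>\<^bsub>G\<^esub> x"
  shows "permutationally_representable k (G \<restriction> M)"
proof -
  obtain w where w: "k \<ge> 1" "represents w G" "\<forall>v \<in> verts G. count_list w v = k"
    using assms(1) unfolding k_word_representable_def by auto
  have "a \<in> set w" using w assms(2) count_list_0_iff[of w a] by auto
  then obtain u v where uv: "w = u @ a # v" by (meson split_list)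
  \<comment> \<open>Rotating a uniform word preserves alternation, so the word may be assumed to start with \<open>a\<close>.\<close>
  let ?r = "(a # v) @ u"
  have rot: "distinct_adj (restrict_word ?r {x, y}) \<longleftrightarrow> x \<rightarrow>\<^bsub>G\<^esub> y"
    if "x \<in> verts G" "y \<in> verts G" "x \<noteq> y" for x y
  proof -
    have "count_list (u @ (a # v)) x = count_list (u @ (a # v)) y" using that w(3) uv by simp
    from distinct_adj_restrict_word_rotate[OF that(3) this] show ?thesis
      using that w(2) uv unfolding represents_iff by auto
  qed
  have cnt: "count_list ?r x = k" if "x \<in> verts G" for x
    using w(3) that by (auto simp: uv)
  let ?w = "restrict_word ?r (insert a M)"
  have ins: "insert a M \<inter> {a, x} = {a, x}" "insert a M \<inter> M = M" if "x \<in> M" for x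
    using that by auto
  have "\<exists>ps. length ps = k \<and> set ps \<subseteq> permutations_of_set M \<and> restrict_word ?w M = concat ps"
  proof (rule split_at_dominating_letter)
    show "\<forall>x \<in> M. count_list ?w x = k \<and> distinct_adj (restrict_word ?w {a, x})"
    proof
      fix x assume x: "x \<in> M"
      then have "x \<in> verts G" "x \<noteq> a" using assms(3,4) by auto
      then have "distinct_adj (restrict_word ?r {a, x})" "count_list ?r x = k"
        using rot[of a x] cnt[of x] dom assms(2) x by blast+
      then show "count_list ?w x = k \<and> distinct_adj (restrict_word ?w {a, x})"
        using x ins(1)[OF x] by (simp only: restrict_word_simps(5) count_list_restrict_word) auto
    qed
    show "count_list ?w a = k"
      using cnt[OF assms(2)] by (simp only: count_list_restrict_word) auto
  qed (use assms(4) in auto)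
  then obtain ps where ps: "length ps = k" "set ps \<subseteq> permutations_of_set M"
      "restrict_word ?r M = concat ps"
    by (auto simp only: restrict_word_simps(5) Int_insert_left_if0[OF assms(4)] Int_absorb)
  have "represents (concat ps) (G \<restriction> M)"
    unfolding represents_iff
  proof (intro conjI ballI impI)
    show "set (concat ps) \<subseteq> verts (G \<restriction> M)"
      using set_concat_permutations[OF ps(2)] by simp
  next
    fix x y assume "x \<in> verts (G \<restriction> M)" "y \<in> verts (G \<restriction> M)" and xy: "x \<noteq> y"
    then have M: "x \<in> M" "y \<in> M" by auto
    then have "M \<inter> {x, y} = {x, y}" by auto
    then have "restrict_word (concat ps) {x, y} = restrict_word ?r {x, y}"
      by (simp only: ps(3)[symmetric] restrict_word_simps(5))
    then show "x \<rightarrow>\<^bsub>G \<restriction> M\<^esub> y \<longleftrightarrow> distinct_adj (restrict_word (concat ps) {x, y})"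
      using rot[OF subsetD[OF assms(3) M(1)] subsetD[OF assms(3) M(2)] xy] M
      by (simp only: arcs_ends_induce_subgraph) simp
  qed
  then show ?thesis
    using w(1) ps unfolding permutationally_representable_def by auto
qed

section \<open>Substituting permutations for the letters of a word\<close>

text \<open>The argument \<open>\<sigma>\<close> holds for each letter the words that are still to be substituted for its
  remaining occurrences, in order. Substituting a different word at each occurrence is essential:
  it is how a single word of the quotient accommodates \<open>k\<close> different permutations of each part.\<close>

fun inflate :: "('c \<Rightarrow> 'a list list) \<Rightarrow> 'c list \<Rightarrow> 'a list" where
  "inflate \<sigma> [] = []"
| "inflate \<sigma> (M # w) = hd (\<sigma> M) @ inflate (\<sigma>(M := tl (\<sigma> M))) w"

lemma inflate_state_step:
  assumes "\<sigma> N = q # qs" "\<forall>X \<in> set (N # w). count_list (N # w) X \<le> length (\<sigma> X)"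
  shows "\<forall>X \<in> set w. count_list w X \<le> length ((\<sigma>(N := qs)) X)"
    "set ((\<sigma>(N := qs)) X) \<subseteq> set (\<sigma> X)"
proof -
  show "\<forall>X \<in> set w. count_list w X \<le> length ((\<sigma>(N := qs)) X)"
  proof
    fix X assume "X \<in> set w"
    then have "count_list (N # w) X \<le> length (\<sigma> X)" using assms(2) by simp
    then show "count_list w X \<le> length ((\<sigma>(N := qs)) X)"
      using assms(1) by (cases "X = N") auto
  qed
  show "set ((\<sigma>(N := qs)) X) \<subseteq> set (\<sigma> X)" using assms(1) by auto
qed

lemma restrict_inflate_same:
  assumes "\<forall>N \<in> set w. count_list w N \<le> length (\<sigma> N)"
    "\<forall>N \<in> set w. N \<noteq> M \<longrightarrow> (\<forall>q \<in> set (\<sigma> N). set q \<inter> B = {})"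
  shows "restrict_word (inflate \<sigma> w) B =
    restrict_word (concat (take (count_list w M) (\<sigma> M))) B"
  using assms
proof (induction w arbitrary: \<sigma>)
  case Nil
  then show ?case by simp
next
  case (Cons N w)
  obtain q qs where q: "\<sigma> N = q # qs"
    using Cons.prems(1) by (cases "\<sigma> N") auto
  have "restrict_word (inflate (\<sigma>(N := qs)) w) B =
      restrict_word (concat (take (count_list w M) ((\<sigma>(N := qs)) M))) B"
  proof (rule Cons.IH)
    show "\<forall>X \<in> set w. X \<noteq> M \<longrightarrow> (\<forall>q \<in> set ((\<sigma>(N := qs)) X). set q \<inter> B = {})"
      using Cons.prems(2) inflate_state_step(2)[of \<sigma>, OF q Cons.prems(1)]
      by (meson list.set_intros(2) subsetD)
  qed (rule inflate_state_step(1)[of \<sigma>, OF q Cons.prems(1)])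
  then show ?case
    using q Cons.prems(2) by (auto simp: restrict_word_none)
qed

lemma restrict_inflate_distinct:
  assumes "\<forall>X \<in> set w. count_list w X \<le> length (\<sigma> X)" "M \<noteq> N"
    "\<forall>X \<in> set w. \<forall>q \<in> set (\<sigma> X).
       restrict_word q {a, b} = (if X = M then [a] else if X = N then [b] else [])"
  shows "restrict_word (inflate \<sigma> w) {a, b} =
    map (\<lambda>X. if X = M then a else b) (restrict_word w {M, N})"
  using assms
proof (induction w arbitrary: \<sigma>)
  case Nil
  then show ?case by simp
next
  case (Cons X w)
  obtain q qs where q: "\<sigma> X = q # qs"
    using Cons.prems(1) by (cases "\<sigma> X") auto
  have "restrict_word (inflate (\<sigma>(X := qs)) w) {a, b} =
      map (\<lambda>X. if X = M then a else b) (restrict_word w {M, N})"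
  proof (rule Cons.IH)
    show "\<forall>Y \<in> set w. \<forall>q \<in> set ((\<sigma>(X := qs)) Y).
        restrict_word q {a, b} = (if Y = M then [a] else if Y = N then [b] else [])"
      using Cons.prems(3) inflate_state_step(2)[of \<sigma>, OF q Cons.prems(1)]
      by (meson list.set_intros(2) subsetD)
  qed (rule inflate_state_step(1)[of \<sigma>, OF q Cons.prems(1)] Cons.prems(2))+
  moreover have "restrict_word q {a, b} = (if X = M then [a] else if X = N then [b] else [])"
    using Cons.prems(3) q by simp
  ultimately show ?case
    using q Cons.prems(2) by simp
qed

lemma inflate_append_distinct:
  assumes "distinct p"
  shows "inflate \<sigma> (p @ w) =
    concat (map (\<lambda>X. hd (\<sigma> X)) p) @ inflate (\<lambda>X. if X \<in> set p then tl (\<sigma> X) else \<sigma> X) w"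
  using assms
proof (induction p arbitrary: \<sigma>)
  case Nil
  then show ?case by simp
next
  case (Cons Y p)
  have "map (\<lambda>X. hd ((\<sigma>(Y := tl (\<sigma> Y))) X)) p = map (\<lambda>X. hd (\<sigma> X)) p"
    using Cons.prems by auto
  moreover have "(\<lambda>X. if X \<in> set p then tl ((\<sigma>(Y := tl (\<sigma> Y))) X) else (\<sigma>(Y := tl (\<sigma> Y))) X) =
      (\<lambda>X. if X \<in> set (Y # p) then tl (\<sigma> X) else \<sigma> X)"
    using Cons.prems by auto
  ultimately show ?case
    using Cons.IH[of "\<sigma>(Y := tl (\<sigma> Y))"] Cons.prems
    by (simp del: fun_upd_apply map_eq_conv)
qed

lemma permutation_of_partition:
  assumes "partition_on V P" "p \<in> permutations_of_set P"
    "\<forall>M \<in> P. f M \<in> permutations_of_set M"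
  shows "concat (map f p) \<in> permutations_of_set V"
proof -
  have p: "set p = P" "distinct p" using assms(2) by (auto simp: permutations_of_set_def)
  have f: "set (f M) = M" "distinct (f M)" if "M \<in> P" for M
    using that assms(3) by (auto simp: permutations_of_set_def)
  have "set (concat (map f p)) = V"
    using f p(1) partition_onD1[OF assms(1)] by auto
  moreover have "distinct (concat (map f p))"
  proof (rule distinct_concat)
    have "inj_on f P" using f(1) by (metis inj_onI)
    then show "distinct (map f p)" using p by (simp add: distinct_map)
  next
    fix ys assume "ys \<in> set (map f p)"
    then show "distinct ys" using f p by auto
  next
    fix ys zs assume "ys \<in> set (map f p)" "zs \<in> set (map f p)" "ys \<noteq> zs"
    then obtain M N where "M \<in> P" "N \<in> P" "M \<noteq> N" "ys = f M" "zs = f N"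
      using p by auto
    then show "set ys \<inter> set zs = {}"
      using f(1) partition_onD2[OF assms(1)] by (auto simp: disjoint_def)
  qed
  ultimately show ?thesis by (auto simp: permutations_of_set_def)
qed

text \<open>If the given word is itself a concatenation of permutations, then the \<open>i\<close>-th occurrences of
  all letters lie in the \<open>i\<close>-th permutation, which is thus inflated to a permutation of the whole
  vertex set.\<close>

lemma inflate_permutations:
  assumes "partition_on V P" "set ps \<subseteq> permutations_of_set P"
    "\<forall>M \<in> P. length (\<sigma> M) = length ps \<and> set (\<sigma> M) \<subseteq> permutations_of_set M"
  shows "\<exists>qs. length qs = length ps \<and> set qs \<subseteq> permutations_of_set V \<and>
    inflate \<sigma> (concat ps) = concat qs"
  using assms(2,3)
proof (induction ps arbitrary: \<sigma>)
  case Nil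
  then show ?case by simp
next
  case (Cons p ps)
  define \<tau> where "\<tau> = (\<lambda>X. if X \<in> set p then tl (\<sigma> X) else \<sigma> X)"
  have p: "p \<in> permutations_of_set P" "set p = P" "distinct p"
    using Cons.prems(1) by (auto simp: permutations_of_set_def)
  have hd_tl: "hd (\<sigma> M) \<in> permutations_of_set M \<and> length (\<tau> M) = length ps \<and>
      set (\<tau> M) \<subseteq> permutations_of_set M" if "M \<in> P" for M
  proof -
    have "length (\<sigma> M) = Suc (length ps)" "set (\<sigma> M) \<subseteq> permutations_of_set M"
      using Cons.prems(2) that by auto
    then show ?thesis using that p(2) by (cases "\<sigma> M") (auto simp: \<tau>_def)
  qed
  obtain qs where qs: "length qs = length ps" "set qs \<subseteq> permutations_of_set V"
      "inflate \<tau> (concat ps) = concat qs"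
    using Cons.IH[of \<tau>] Cons.prems(1) hd_tl by auto
  let ?q = "concat (map (\<lambda>X. hd (\<sigma> X)) p)"
  have "?q \<in> permutations_of_set V"
    using hd_tl by (intro permutation_of_partition[OF assms(1) p(1)]) auto
  moreover have "inflate \<sigma> (concat (p # ps)) = concat (?q # qs)"
    using inflate_append_distinct[OF p(3), of \<sigma> "concat ps"] qs(3) by (simp add: \<tau>_def)
  ultimately show ?case
    using qs by (intro exI[of _ "?q # qs"]) auto
qed

lemma count_list_concat_permutations:
  assumes "set ps \<subseteq> permutations_of_set V" "a \<in> V"
  shows "count_list (concat ps) a = length ps"
  using assms by (induction ps) (auto simp: permutations_of_set_def count_list_distinct)

section \<open>Modular partitions\<close>

lemma dominates_sym:
  assumes "graph G" "a \<rightarrow>\<^bsub>G\<^esub> b"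
  shows "b \<rightarrow>\<^bsub>G\<^esub> a"
proof -
  interpret graph G by fact
  show ?thesis using graph_symmetric assms(2) by blast
qed

lemma dominates_verts:
  assumes "graph G" "a \<rightarrow>\<^bsub>G\<^esub> b"
  shows "a \<in> verts G \<and> b \<in> verts G \<and> a \<noteq> b"
proof -
  interpret graph G by fact
  show ?thesis using assms(2) adj_not_same by (auto simp: arcs_ends_conv)
qed

lemma dominates_quotient_graph:
  "M \<rightarrow>\<^bsub>quotient_graph G P\<^esub> N \<longleftrightarrow> M \<in> P \<and> N \<in> P \<and> M \<noteq> N \<and> adjacent_modules G M N"
  by (auto simp: arcs_ends_conv quotient_graph_def)

lemma verts_quotient_graph [simp]: "verts (quotient_graph G P) = P"
  by (simp add: quotient_graph_def)

text \<open>Two adjacent vertices make their modules adjacent: as the modules are disjoint, the edge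
  can be moved to any other endpoint within \<open>M\<close>, and then within \<open>N\<close>.\<close>

lemma adjacent_modules_iff:
  assumes "graph G" "graph_module G M" "graph_module G N" "M \<inter> N = {}" "a \<in> M" "b \<in> N"
  shows "adjacent_modules G M N \<longleftrightarrow> a \<rightarrow>\<^bsub>G\<^esub> b"
proof
  assume ab: "a \<rightarrow>\<^bsub>G\<^esub> b"
  show "adjacent_modules G M N"
    unfolding adjacent_modules_def
  proof (intro ballI)
    fix a' b' assume a': "a' \<in> M" and b': "b' \<in> N"
    have "b \<in> verts G - M" "a' \<in> verts G - N"
      using assms a' by (auto simp: graph_module_def)
    then have "M \<subseteq> neighbours G b \<or> neighbours G b \<inter> M = {}"
      "N \<subseteq> neighbours G a' \<or> neighbours G a' \<inter> N = {}"
      using assms(2,3) by (auto simp: graph_module_def)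
    moreover have "a \<in> neighbours G b \<inter> M"
      using dominates_sym[OF assms(1) ab] assms(5) by (simp add: neighbours_def)
    ultimately have "b \<rightarrow>\<^bsub>G\<^esub> a'" and N: "N \<subseteq> neighbours G a' \<or> neighbours G a' \<inter> N = {}"
      using a' by (auto simp: neighbours_def)
    then have "b \<in> neighbours G a' \<inter> N"
      using dominates_sym[OF assms(1)] assms(6) by (simp add: neighbours_def)
    then show "a' \<rightarrow>\<^bsub>G\<^esub> b'" using N b' by (auto simp: neighbours_def)
  qed
qed (use assms in \<open>auto simp: adjacent_modules_def\<close>)

lemma modular_partition_facts:
  assumes "modular_partition G P" "M \<in> P"
  shows "graph_module G M" "M \<subseteq> verts G" "M \<noteq> {}"
    "N \<in> P \<Longrightarrow> M \<noteq> N \<Longrightarrow> M \<inter> N = {}"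
  using assms partition_onD1[of "verts G" P] partition_onD2[of "verts G" P]
    partition_onD3[of "verts G" P]
  unfolding modular_partition_def disjoint_def by blast+

text \<open>Any choice of one vertex from each part induces a copy of the quotient.\<close>

lemma induced_embedding_quotient_graph:
  assumes "graph G" "modular_partition G P"
  shows "induced_embedding (\<lambda>M. SOME x. x \<in> M) (quotient_graph G P) G"
proof -
  let ?f = "\<lambda>M::'a set. SOME x. x \<in> M"
  have f: "?f M \<in> M" if "M \<in> P" for M
    using modular_partition_facts(3)[OF assms(2) that] by (simp add: some_in_eq)
  have "inj_on ?f P"
  proof (rule inj_onI)
    fix M N assume "M \<in> P" "N \<in> P" "?f M = ?f N"
    then show "M = N"
      using f[of M] f[of N] modular_partition_facts(4)[OF assms(2)] by (metis disjoint_iff)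
  qed
  moreover have "?f ` P \<subseteq> verts G"
    using f modular_partition_facts(2)[OF assms(2)] by auto
  moreover have "M \<rightarrow>\<^bsub>quotient_graph G P\<^esub> N \<longleftrightarrow> ?f M \<rightarrow>\<^bsub>G\<^esub> ?f N"
    if "M \<in> P" "N \<in> P" "M \<noteq> N" for M N
    using adjacent_modules_iff[OF assms(1), of M N "?f M" "?f N"] that f
      modular_partition_facts[OF assms(2)] by (simp add: dominates_quotient_graph)
  ultimately show ?thesis by (simp add: induced_embedding_def)
qed

text \<open>For a module \<open>M\<close> such an edge is enough to make its endpoint \<open>a\<close> adjacent to all of \<open>M\<close>.\<close>

lemma connected_crossing_edge:
  assumes "graph G" "connected G" "M \<subseteq> verts G" "M \<noteq> {}" "M \<noteq> verts G"
  obtains a b where "a \<in> verts G - M" "b \<in> M" "a \<rightarrow>\<^bsub>G\<^esub> b"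
proof -
  interpret graph G by fact
  obtain x y where xy: "x \<in> M" "y \<in> verts G - M" using assms(3-5) by blast
  have "x \<rightarrow>\<^sup>*\<^bsub>with_proj (mk_symmetric G)\<^esub> y"
    using assms(2,3) xy by (auto simp: connected_def elim!: strongly_connectedE)
  then have "x \<rightarrow>\<^sup>*\<^bsub>G\<^esub> y" using reachable_mk_symmetric_eq sym_arcs by blast
  then have "\<exists>a b. a \<in> verts G - M \<and> b \<in> M \<and> a \<rightarrow>\<^bsub>G\<^esub> b"
    if "y \<notin> M" using that
  proof (induction rule: reachable_induct)
    case base
    then show ?case using xy by blast
  next
    case (step u v)
    then show ?case
      using dominates_sym[OF assms(1)] dominates_verts[OF assms(1)] by blast
  qed
  then show thesis using xy that by blast
qed

text \<open>The substituted word represents \<open>G\<close>: on letters of one part it spells out the permutations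
  of that part, and on letters of two parts it is a renamed copy of the given word of the quotient.\<close>

lemma represents_inflate:
  assumes "graph G" "modular_partition G P"
    and w: "represents w (quotient_graph G P)" "\<forall>M \<in> P. count_list w M = k"
    and \<sigma>: "\<And>M. M \<in> P \<Longrightarrow> length (\<sigma> M) = k"
      "\<And>M. M \<in> P \<Longrightarrow> set (\<sigma> M) \<subseteq> permutations_of_set M"
      "\<And>M. M \<in> P \<Longrightarrow> represents (concat (\<sigma> M)) (G \<restriction> M)"
  shows "represents (inflate \<sigma> w) G \<and> (\<forall>v \<in> verts G. count_list (inflate \<sigma> w) v = k)"
proof -
  have part: "partition_on (verts G) P" using assms(2) by (simp add: modular_partition_def)
  have wP: "set w \<subseteq> P" using w(1) by (simp add: represents_iff)
  have len: "\<forall>N \<in> set w. count_list w N \<le> length (\<sigma> N)"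
    using wP w(2) \<sigma>(1) by auto
  have perm: "set q = M" "distinct q" if "M \<in> P" "q \<in> set (\<sigma> M)" for M q
    using \<sigma>(2)[OF that(1)] that(2) by (auto simp: permutations_of_set_def)
  have same: "restrict_word (inflate \<sigma> w) B = restrict_word (concat (\<sigma> M)) B"
    if "M \<in> P" "B \<subseteq> M" for M B
  proof -
    have "\<forall>N \<in> set w. N \<noteq> M \<longrightarrow> (\<forall>q \<in> set (\<sigma> N). set q \<inter> B = {})"
      using wP perm that modular_partition_facts(4)[OF assms(2)] by blast
    from restrict_inflate_same[OF len this] show ?thesis
      using that w(2) \<sigma>(1) by simp
  qed
  have "count_list (inflate \<sigma> w) v = k" if v: "v \<in> verts G" for v
  proof -
    obtain M where M: "M \<in> P" "v \<in> M" using v partition_onD1[OF part] by auto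
    then show ?thesis
      using same[OF M(1), of "{v}"] count_list_concat_permutations[OF \<sigma>(2) M(2)] \<sigma>(1)
      by (simp add: count_list_eq_length)
  qed
  moreover have "set (inflate \<sigma> w) \<subseteq> verts G"
  proof -
    \<comment> \<open>The empty set is not a part, so it serves as a letter that does not occur in \<open>w\<close>.\<close>
    have "\<forall>N \<in> set w. \<forall>q \<in> set (\<sigma> N). set q \<inter> - verts G = {}"
      using wP perm modular_partition_facts(2)[OF assms(2)] by blast
    then have "restrict_word (inflate \<sigma> w) (- verts G) =
        restrict_word (concat (take (count_list w {}) (\<sigma> {}))) (- verts G)"
      by (intro restrict_inflate_same[OF len]) auto
    moreover have "count_list w {} = 0"
      using wP modular_partition_facts(3)[OF assms(2)] by (auto simp: count_list_0_iff)
    ultimately have "set (restrict_word (inflate \<sigma> w) (- verts G)) = {}" by simp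
    then show ?thesis by auto
  qed
  moreover have "a \<rightarrow>\<^bsub>G\<^esub> b \<longleftrightarrow> distinct_adj (restrict_word (inflate \<sigma> w) {a, b})"
    if ab: "a \<in> verts G" "b \<in> verts G" "a \<noteq> b" for a b
  proof -
    obtain M N where MN: "M \<in> P" "a \<in> M" "N \<in> P" "b \<in> N"
      using ab partition_onD1[OF part] by auto
    show ?thesis
    proof (cases "M = N")
      case True
      then have "restrict_word (inflate \<sigma> w) {a, b} = restrict_word (concat (\<sigma> M)) {a, b}"
        using MN by (intro same) auto
      moreover have "a \<rightarrow>\<^bsub>G\<^esub> b \<longleftrightarrow> a \<rightarrow>\<^bsub>G \<restriction> M\<^esub> b"
        using MN True by (simp add: arcs_ends_induce_subgraph)
      ultimately show ?thesis
        using \<sigma>(3)[OF MN(1)] MN True \<open>a \<noteq> b\<close> unfolding represents_iff by auto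
    next
      case False
      have disj: "X \<inter> Y = {}" if "X \<in> P" "Y \<in> P" "X \<noteq> Y" for X Y
        using that modular_partition_facts(4)[OF assms(2)] by blast
      let ?ren = "\<lambda>X. if X = M then a else b"
      have "\<forall>X \<in> set w. \<forall>q \<in> set (\<sigma> X).
          restrict_word q {a, b} = (if X = M then [a] else if X = N then [b] else [])"
      proof (intro ballI)
        fix X q assume "X \<in> set w" and q: "q \<in> set (\<sigma> X)"
        then have X: "X \<in> P" using wP by auto
        have "{a, b} \<inter> X = (if X = M then {a} else if X = N then {b} else {})"
          using MN disj[OF X MN(1)] disj[OF X MN(3)] disj[OF MN(1,3) False] by auto
        moreover have "restrict_word q {} = []" by (simp add: restrict_word_def)
        ultimately show "restrict_word q {a, b} = (if X = M then [a] else if X = N then [b] else [])"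
          using perm[OF X q] restrict_word_Int_set[of q "{a, b}"] MN
          by (simp add: restrict_word_single count_list_distinct)
      qed
      from restrict_inflate_distinct[OF len False this]
      have "restrict_word (inflate \<sigma> w) {a, b} = map ?ren (restrict_word w {M, N})" .
      moreover have "inj_on ?ren (set (restrict_word w {M, N}))"
        using \<open>a \<noteq> b\<close> by (auto simp: inj_on_def)
      moreover have "distinct_adj (restrict_word w {M, N}) \<longleftrightarrow> adjacent_modules G M N"
        using w(1) MN False by (simp add: represents_iff dominates_quotient_graph)
      moreover have "adjacent_modules G M N \<longleftrightarrow> a \<rightarrow>\<^bsub>G\<^esub> b"
        using MN False disj modular_partition_facts(1)[OF assms(2)]
        by (intro adjacent_modules_iff[OF assms(1)]) auto
      ultimately show ?thesis by (simp add: distinct_adj_map_iff)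
    qed
  qed
  ultimately show ?thesis unfolding represents_iff by blast
qed

lemma obtain_part_permutations:
  assumes "\<forall>M \<in> P. permutationally_representable k (G \<restriction> M)"
  obtains \<sigma> where "\<And>M. M \<in> P \<Longrightarrow> length (\<sigma> M) = k"
    "\<And>M. M \<in> P \<Longrightarrow> set (\<sigma> M) \<subseteq> permutations_of_set M"
    "\<And>M. M \<in> P \<Longrightarrow> represents (concat (\<sigma> M)) (G \<restriction> M)"
proof -
  have "\<forall>M \<in> P. \<exists>ps. length ps = k \<and> set ps \<subseteq> permutations_of_set M \<and>
      represents (concat ps) (G \<restriction> M)"
    using assms unfolding permutationally_representable_def by simp
  from bchoice[OF this] show thesis using that by blast
qed

section \<open>Representability of a graph in terms of a modular partition\<close>

lemma k_word_representable_iff_quotient: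
  assumes "graph G" "connected G" "modular_partition G P" "P \<noteq> {verts G}"
  shows "k_word_representable k G \<longleftrightarrow>
    k_word_representable k (quotient_graph G P) \<and>
    (\<forall>M \<in> P. permutationally_representable k (G \<restriction> M))"
proof (intro iffI conjI ballI)
  assume k: "k_word_representable k G"
  show "k_word_representable k (quotient_graph G P)"
    by (rule k_word_representable_induced[OF induced_embedding_quotient_graph[OF assms(1,3)] k])
  fix M assume M: "M \<in> P"
  note facts = modular_partition_facts[OF assms(3) M]
  have "M \<noteq> verts G"
  proof
    assume "M = verts G"
    then have "N = M" if "N \<in> P" for N
      using that facts(4)[of N] modular_partition_facts(2,3)[OF assms(3) that] by blast
    then show False using M \<open>M = verts G\<close> assms(4) by blast
  qed
  then obtain a b where ab: "a \<in> verts G - M" "b \<in> M" "a \<rightarrow>\<^bsub>G\<^esub> b"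
    using connected_crossing_edge[OF assms(1,2) facts(2,3)] by blast
  then have "M \<subseteq> neighbours G a"
    using facts(1) unfolding graph_module_def neighbours_def by blast
  then show "permutationally_representable k (G \<restriction> M)"
    using ab facts(2) by (intro permutationally_representable_if_dominated[OF k, of a])
      (auto simp: neighbours_def)
next
  assume *: "k_word_representable k (quotient_graph G P) \<and>
    (\<forall>M \<in> P. permutationally_representable k (G \<restriction> M))"
  then obtain w where w: "k \<ge> 1" "represents w (quotient_graph G P)" "\<forall>M \<in> P. count_list w M = k"
    unfolding k_word_representable_def by auto
  obtain \<sigma> where \<sigma>: "\<And>M. M \<in> P \<Longrightarrow> length (\<sigma> M) = k"
    "\<And>M. M \<in> P \<Longrightarrow> set (\<sigma> M) \<subseteq> permutations_of_set M"
    "\<And>M. M \<in> P \<Longrightarrow> represents (concat (\<sigma> M)) (G \<restriction> M)"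
    using obtain_part_permutations[of P k G] * by blast
  show "k_word_representable k G"
    using represents_inflate[OF assms(1,3) w(2,3) \<sigma>] w(1)
    unfolding k_word_representable_def by blast
qed

lemma permutationally_representable_iff_quotient:
  assumes "graph G" "modular_partition G P"
  shows "permutationally_representable k G \<longleftrightarrow>
    permutationally_representable k (quotient_graph G P) \<and>
    (\<forall>M \<in> P. permutationally_representable k (G \<restriction> M))"
proof (intro iffI conjI ballI)
  assume k: "permutationally_representable k G"
  show "permutationally_representable k (quotient_graph G P)"
    by (rule permutationally_representable_induced[OF induced_embedding_quotient_graph[OF assms] k])
  fix M assume "M \<in> P"
  then show "permutationally_representable k (G \<restriction> M)"
    by (intro permutationally_representable_induced[OF induced_embedding_induce_subgraph k]
        modular_partition_facts(2)[OF assms(2)])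
next
  assume *: "permutationally_representable k (quotient_graph G P) \<and>
    (\<forall>M \<in> P. permutationally_representable k (G \<restriction> M))"
  then obtain ps where ps: "k \<ge> 1" "length ps = k" "set ps \<subseteq> permutations_of_set P"
      "represents (concat ps) (quotient_graph G P)"
    unfolding permutationally_representable_def by auto
  obtain \<sigma> where \<sigma>: "\<And>M. M \<in> P \<Longrightarrow> length (\<sigma> M) = k"
    "\<And>M. M \<in> P \<Longrightarrow> set (\<sigma> M) \<subseteq> permutations_of_set M"
    "\<And>M. M \<in> P \<Longrightarrow> represents (concat (\<sigma> M)) (G \<restriction> M)"
    using obtain_part_permutations[of P k G] * by blast
  have "\<forall>M \<in> P. count_list (concat ps) M = k"
    using count_list_concat_permutations[OF ps(3)] ps(2) by simp
  from represents_inflate[OF assms ps(4) this \<sigma>]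
  have "represents (inflate \<sigma> (concat ps)) G" by blast
  moreover obtain qs where "length qs = k" "set qs \<subseteq> permutations_of_set (verts G)"
      "inflate \<sigma> (concat ps) = concat qs"
    using inflate_permutations[of "verts G" P ps \<sigma>] assms(2) ps(2,3) \<sigma>(1,2)
    unfolding modular_partition_def by auto
  ultimately show "permutationally_representable k G"
    using ps(1) unfolding permutationally_representable_def by auto
qed

theorem theorem8:
  fixes G :: "('a, 'b) pre_digraph" and P :: "'a set set"
  assumes "graph G"
    and "connected G"
    and "decomposable_graph G"
    and "modular_partition G P"
  shows
    "(P \<noteq> {verts G} \<longrightarrow>
        (word_representable G \<longleftrightarrow>
          (\<forall>M \<in> P. comparability_graph (G \<restriction> M)) \<and> word_representable (quotient_graph G P)))
     \<and>
     (P \<noteq> {verts G} \<longrightarrow> word_representable G \<longrightarrow>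
        representation_number G =
          Max (insert (representation_number (quotient_graph G P))
                 ((\<lambda>M. permutation_representation_number (G \<restriction> M)) ` P)))
     \<and>
     (comparability_graph G \<longrightarrow>
        permutation_representation_number G =
          Max (insert (permutation_representation_number (quotient_graph G P))
                 ((\<lambda>M. permutation_representation_number (G \<restriction> M)) ` P)))"
proof -
  interpret graph G by fact
  let ?Q = "quotient_graph G P"
  have finP: "finite P"
    using finite_elements[OF finite_verts] assms(4) by (auto simp: modular_partition_def)
  have finM: "finite (verts (G \<restriction> M))" if "M \<in> P" for M
    using finite_subset[OF modular_partition_facts(2)[OF assms(4) that] finite_verts] by simp
  have comparability: "comparability_graph (G \<restriction> M) \<longleftrightarrow>
      (\<exists>k. permutationally_representable k (G \<restriction> M))" if "M \<in> P" for M
    using permutationally_representable_if_comparability_graph[OF finM[OF that]]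
      comparability_graph_if_permutationally_representable[of _ "G \<restriction> M"]
      dominates_verts[OF assms(1)]
    by (auto simp: arcs_ends_induce_subgraph)
  have word: "word_representable G \<longleftrightarrow>
      (\<forall>M \<in> P. comparability_graph (G \<restriction> M)) \<and> word_representable ?Q"
    if P: "P \<noteq> {verts G}"
  proof
    assume "word_representable G"
    then obtain k where "k_word_representable k G"
      using word_representable_iff_k_word_representable[OF finite_verts] by blast
    then have "k_word_representable k ?Q" "\<forall>M \<in> P. permutationally_representable k (G \<restriction> M)"
      using k_word_representable_iff_quotient[OF assms(1,2,4) P] by blast+
    then show "(\<forall>M \<in> P. comparability_graph (G \<restriction> M)) \<and> word_representable ?Q"
      using comparability word_representable_iff_k_word_representable[of ?Q] finP by auto
  next
    assume *: "(\<forall>M \<in> P. comparability_graph (G \<restriction> M)) \<and> word_representable ?Q"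
    let ?m = "Max (insert (representation_number ?Q)
      ((\<lambda>M. permutation_representation_number (G \<restriction> M)) ` P))"
    \<comment> \<open>Any common upper bound of the representation numbers would do.\<close>
    have "k_word_representable ?m ?Q"
      using * finP by (subst representation_number_le_iff[symmetric]) auto
    moreover have "permutationally_representable ?m (G \<restriction> M)" if M: "M \<in> P" for M
    proof -
      obtain k where "permutationally_representable k (G \<restriction> M)"
        using * comparability M by blast
      then show ?thesis
        using finP M by (subst permutation_representation_number_le_iff[symmetric]) auto
    qed
    ultimately have "k_word_representable ?m G"
      using k_word_representable_iff_quotient[OF assms(1,2,4) P] by blast
    then show "word_representable G"
      using word_representable_iff_k_word_representable[OF finite_verts] by blast
  qed
  \<comment> \<open>A maximum is determined by its upper bounds, so thresholds can be compared one \<open>k\<close> at a time.\<close>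
  have eq_Max: "r = Max (insert q (f ` P))"
    if "\<And>k. r \<le> k \<longleftrightarrow> q \<le> k \<and> (\<forall>M \<in> P. f M \<le> k)" for r q :: nat and f :: "'a set \<Rightarrow> nat"
  proof -
    have "r \<le> k \<longleftrightarrow> Max (insert q (f ` P)) \<le> k" for k
      using that[of k] finP by simp
    then show ?thesis by (metis dual_order.refl order_antisym)
  qed
  have "representation_number G = Max (insert (representation_number ?Q)
      ((\<lambda>M. permutation_representation_number (G \<restriction> M)) ` P))"
    if P: "P \<noteq> {verts G}" and G: "word_representable G"
  proof (rule eq_Max)
    fix k
    have "permutation_representation_number (G \<restriction> M) \<le> k \<longleftrightarrow>
        permutationally_representable k (G \<restriction> M)" if "M \<in> P" for M
      using word[OF P] G comparability[OF that] that permutation_representation_number_le_iff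
      by blast
    moreover have "representation_number ?Q \<le> k \<longleftrightarrow> k_word_representable k ?Q"
      using word[OF P] G finP by (intro representation_number_le_iff) auto
    ultimately show "representation_number G \<le> k \<longleftrightarrow> representation_number ?Q \<le> k \<and>
        (\<forall>M \<in> P. permutation_representation_number (G \<restriction> M) \<le> k)"
      using k_word_representable_iff_quotient[OF assms(1,2,4) P, of k]
        representation_number_le_iff[OF finite_verts G, of k] by simp
  qed
  moreover have "permutation_representation_number G =
      Max (insert (permutation_representation_number ?Q)
        ((\<lambda>M. permutation_representation_number (G \<restriction> M)) ` P))"
    if comp: "comparability_graph G"
  proof (rule eq_Max)
    fix k
    obtain m where m: "permutationally_representable m G"
      using permutationally_representable_if_comparability_graph[OF finite_verts comp] by blast
    then have parts: "permutationally_representable m ?Q"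
        "\<And>M. M \<in> P \<Longrightarrow> permutationally_representable m (G \<restriction> M)"
      using permutationally_representable_iff_quotient[OF assms(1,4)] by blast+
    show "permutation_representation_number G \<le> k \<longleftrightarrow> permutation_representation_number ?Q \<le> k \<and>
        (\<forall>M \<in> P. permutation_representation_number (G \<restriction> M) \<le> k)"
      using permutationally_representable_iff_quotient[OF assms(1,4), of k]
        permutation_representation_number_le_iff[OF m, of k]
        permutation_representation_number_le_iff[OF parts(1), of k]
        permutation_representation_number_le_iff[OF parts(2), of _ k] by simp
  qed
  ultimately show ?thesis using word by blast
qed

end
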